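(* Let $r \ge 2$ be an integer, let $E$ be the (finite) set of edges of some $r$-uniform hypergraph, and let $n > 1$ be a rational number. Then the simplicial complex $X = \{E' \subseteq E:\ \nu^*(E') < n\}$ on the vertex set $E$ is $(\lceil rn \rceil - 1)$-collapsible.
   Context: An $r$-uniform hypergraph has edges that are $r$-element subsets of a finite vertex set. For a set $E'$ of edges, $\nu^*(E')$ is the maximum of $\sum_{e\in E'} f(e)$ over functions $f\colon E'\to\mathbb{R}_{\ge0}$ with $\sum_{e\in E',\,e\ni v} f(e)\le 1$ for every vertex $v$ (the fractional matching number). A simplicial complex is a family of subsets closed under taking subsets; a facet is an inclusion-maximal face. For a positive integer $d$: if $\sigma$ is a face of $X$ contained in a unique facet of $X$ and $|\sigma| \le d$, removing $\sigma$ and all faces containing it is an elementary $d$-collapse; $X$ is $d$-collapsible if a finite sequence of elementary $d$-collapses reduces $X$ to $\{\emptyset\}$. *)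

theory Defs
  imports "HOL-Analysis.Analysis"
begin

definition uniform_hypergraph :: "nat \<Rightarrow> 'a set \<Rightarrow> 'a set set \<Rightarrow> bool" where
  "uniform_hypergraph r V E \<longleftrightarrow> finite V \<and> (\<forall>e\<in>E. e \<subseteq> V \<and> card e = r)"

(* Only the values of f on F matter. Points v outside all edges of F impose the void
   constraint 0 \<le> 1, so v may range over the whole type. *)
definition fractional_matching :: "'a set set \<Rightarrow> ('a set \<Rightarrow> real) \<Rightarrow> bool" where
  "fractional_matching F f \<longleftrightarrow>
     (\<forall>e\<in>F. 0 \<le> f e) \<and> (\<forall>v. (\<Sum>e | e \<in> F \<and> v \<in> e. f e) \<le> 1)"

(* For a finite family F of nonempty edges the supremum is a maximum:
   see fractional_matching_number_attained and fractional_matching_number_upper. *)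
definition fractional_matching_number :: "'a set set \<Rightarrow> real" where
  "fractional_matching_number F = Sup {(\<Sum>e\<in>F. f e) | f. fractional_matching F f}"

definition abstract_simplicial_complex :: "'b set \<Rightarrow> 'b set set \<Rightarrow> bool" where
  "abstract_simplicial_complex S X \<longleftrightarrow>
     (\<forall>\<sigma>\<in>X. \<sigma> \<subseteq> S) \<and> (\<forall>\<sigma>\<in>X. \<forall>\<tau>. \<tau> \<subseteq> \<sigma> \<longrightarrow> \<tau> \<in> X)"

definition facet :: "'b set set \<Rightarrow> 'b set \<Rightarrow> bool" where
  "facet X \<tau> \<longleftrightarrow> \<tau> \<in> X \<and> (\<forall>\<rho>\<in>X. \<tau> \<subseteq> \<rho> \<longrightarrow> \<rho> = \<tau>)"

definition elementary_collapse :: "nat \<Rightarrow> 'b set set \<Rightarrow> 'b set set \<Rightarrow> bool" where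
  "elementary_collapse d X Y \<longleftrightarrow>
     (\<exists>\<sigma>\<in>X. finite \<sigma> \<and> card \<sigma> \<le> d \<and> (\<exists>!\<tau>. facet X \<tau> \<and> \<sigma> \<subseteq> \<tau>) \<and>
            Y = {\<tau> \<in> X. \<not> \<sigma> \<subseteq> \<tau>})"

definition d_collapsible :: "nat \<Rightarrow> 'b set set \<Rightarrow> bool" where
  "d_collapsible d X \<longleftrightarrow> (elementary_collapse d)\<^sup>*\<^sup>* X {{}}"

definition fractional_matching_complex :: "'a set set \<Rightarrow> rat \<Rightarrow> 'a set set set" where
  "fractional_matching_complex E n =
     {F. F \<subseteq> E \<and> fractional_matching_number F < of_rat n}"

lemma fractional_matching_zero: "fractional_matching F (\<lambda>_. 0)"
  by (simp add: fractional_matching_def)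

lemma fractional_matching_le_1:
  assumes "finite F" "{} \<notin> F" "fractional_matching F f" "e \<in> F"
  shows "f e \<le> 1"
proof -
  obtain v where v: "v \<in> e" using assms(2,4) by fastforce
  have "f e \<le> (\<Sum>e | e \<in> F \<and> v \<in> e. f e)"
    using assms v by (intro member_le_sum) (auto simp: fractional_matching_def)
  also have "\<dots> \<le> 1" using assms(3) by (simp add: fractional_matching_def)
  finally show ?thesis .
qed

lemma fractional_matching_number_upper:
  assumes "finite F" "{} \<notin> F" "fractional_matching F f"
  shows "(\<Sum>e\<in>F. f e) \<le> fractional_matching_number F"
  unfolding fractional_matching_number_def
proof (rule cSup_upper)
  show "(\<Sum>e\<in>F. f e) \<in> {(\<Sum>e\<in>F. f e) | f. fractional_matching F f}"
    using assms(3) by blast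
  have "(\<Sum>e\<in>F. g e) \<le> (\<Sum>e\<in>F. 1)" if "fractional_matching F g" for g
    using fractional_matching_le_1[OF assms(1,2) that] by (rule sum_mono)
  then show "bdd_above {(\<Sum>e\<in>F. f e) | f. fractional_matching F f}"
    by (intro bdd_aboveI[where M = "\<Sum>e\<in>F. 1"]) blast
qed

lemma fractional_matching_number_attained:
  assumes "finite F" "{} \<notin> F"
  shows "\<exists>f. fractional_matching F f \<and> (\<Sum>e\<in>F. f e) = fractional_matching_number F"
proof -
  define B where "B = (\<Pi>\<^sub>E e\<in>UNIV. if e \<in> F then {0..1::real} else {0})"
  define K where "K = B \<inter> {f. \<forall>v. (\<Sum>e | e \<in> F \<and> v \<in> e. f e) \<le> 1}"
  have "compactin (product_topology (\<lambda>_::'a set. euclidean) UNIV) B"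
    unfolding B_def by (subst compactin_PiE) auto
  then have "compact B" by (simp add: euclidean_product_topology)
  moreover have "closed {f. \<forall>v. (\<Sum>e | e \<in> F \<and> v \<in> e. (f :: 'a set \<Rightarrow> real) e) \<le> 1}"
    by (intro closed_Collect_all closed_Collect_le continuous_intros
        continuous_on_sum continuous_on_product_coordinates)
  ultimately have "compact K" unfolding K_def by (rule compact_Int_closed)
  moreover have "(\<lambda>_. 0) \<in> K" by (auto simp: K_def B_def PiE_iff)
  moreover have "continuous_on K (\<lambda>f. \<Sum>e\<in>F. f e)"
    by (intro continuous_on_sum continuous_on_subset[OF continuous_on_product_coordinates]) auto
  ultimately obtain f where f: "f \<in> K" and max: "\<And>g. g \<in> K \<Longrightarrow> (\<Sum>e\<in>F. g e) \<le> (\<Sum>e\<in>F. f e)"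
    using continuous_attains_sup[of K "\<lambda>f. \<Sum>e\<in>F. f e"] by blast
  have fm: "fractional_matching F f"
    using f by (auto simp: fractional_matching_def K_def B_def PiE_iff split: if_splits)
  have "fractional_matching_number F \<le> (\<Sum>e\<in>F. f e)"
    unfolding fractional_matching_number_def
  proof (rule cSup_least)
    show "{(\<Sum>e\<in>F. f e) | f. fractional_matching F f} \<noteq> {}"
      using fm by blast
    fix x assume "x \<in> {(\<Sum>e\<in>F. f e) | f. fractional_matching F f}"
    then obtain g where g: "fractional_matching F g" "x = (\<Sum>e\<in>F. g e)" by blast
    define h where "h = (\<lambda>e. if e \<in> F then g e else 0)"
    have "(\<Sum>e | e \<in> F \<and> v \<in> e. h e) = (\<Sum>e | e \<in> F \<and> v \<in> e. g e)" for v
      by (rule sum.cong) (auto simp: h_def)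
    then have "h \<in> K"
      using g(1) fractional_matching_le_1[OF assms g(1)]
      by (auto simp: K_def B_def h_def fractional_matching_def)
    moreover have "x = (\<Sum>e\<in>F. h e)" by (simp add: g(2) h_def)
    ultimately show "x \<le> (\<Sum>e\<in>F. f e)" using max by simp
  qed
  with fm fractional_matching_number_upper[OF assms fm] show ?thesis by force
qed

lemma uniform_hypergraph_finite:
  assumes "uniform_hypergraph r V E"
  shows "finite E"
  using assms by (auto simp: uniform_hypergraph_def intro: finite_subset[of E "Pow V"])

lemma fractional_matching_number_mono:
  assumes "finite F" "{} \<notin> F" "G \<subseteq> F"
  shows "fractional_matching_number G \<le> fractional_matching_number F"
proof -
  have G: "finite G" "{} \<notin> G" using assms finite_subset by auto
  obtain g where g: "fractional_matching G g" "(\<Sum>e\<in>G. g e) = fractional_matching_number G"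
    using fractional_matching_number_attained[OF G] by blast
  define h where "h = (\<lambda>e. if e \<in> G then g e else 0)"
  have "(\<Sum>e | e \<in> F \<and> v \<in> e. h e) = (\<Sum>e | e \<in> G \<and> v \<in> e. g e)" for v
    using assms(1,3) by (intro sum.mono_neutral_cong_right) (auto simp: h_def)
  then have "fractional_matching F h"
    using g(1) by (auto simp: fractional_matching_def h_def)
  then have "(\<Sum>e\<in>F. h e) \<le> fractional_matching_number F"
    by (rule fractional_matching_number_upper[OF assms(1,2)])
  moreover have "(\<Sum>e\<in>F. h e) = (\<Sum>e\<in>G. g e)"
    using assms(1,3) by (intro sum.mono_neutral_cong_right) (auto simp: h_def)
  ultimately show ?thesis using g(2) by simp
qed

lemma fractional_matching_complex_simplicial:
  assumes "uniform_hypergraph r V E" "r > 0"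
  shows "abstract_simplicial_complex E (fractional_matching_complex E n)"
  unfolding abstract_simplicial_complex_def
proof (intro conjI ballI allI impI)
  fix \<sigma> assume s: "\<sigma> \<in> fractional_matching_complex E n"
  then show "\<sigma> \<subseteq> E" by (simp add: fractional_matching_complex_def)
  fix \<tau> assume "\<tau> \<subseteq> \<sigma>"
  moreover have "finite \<sigma>"
    using \<open>\<sigma> \<subseteq> E\<close> uniform_hypergraph_finite[OF assms(1)] finite_subset by blast
  moreover have "{} \<notin> \<sigma>"
    using \<open>\<sigma> \<subseteq> E\<close> assms by (force simp: uniform_hypergraph_def)
  ultimately have "fractional_matching_number \<tau> \<le> fractional_matching_number \<sigma>"
    by (intro fractional_matching_number_mono)
  then show "\<tau> \<in> fractional_matching_complex E n"
    using s \<open>\<tau> \<subseteq> \<sigma>\<close> by (auto simp: fractional_matching_complex_def)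
qed

end

theory Submission
  imports Defs
begin

text \<open>
  Replace the capacities 1 and the edge weights 1 of the matching linear program by generic numbers
  slightly below 1. If the perturbation is small, the complex is a strict sublevel set of the
  optimal value \<open>M F\<close> of the perturbed program. By genericity every optimum is basic and
  nondegenerate, distinct optima have distinct values, and an optimum common to two edge sets is
  optimal for their union. Hence the faces of maximal value \<open>M\<close> are exactly the faces
  containing the support of one fixed optimum, and they have a largest member, so they can be
  removed by one elementary collapse. Repeating this sweeps the complex down to the empty face.
  The support of a basic optimum has at most as many edges as there are saturated vertices, and
  since every edge has \<open>r\<close> vertices, there are fewer than \<open>r n\<close> of these.
\<close>

section \<open>Linear systems and generic vectors\<close>

text \<open>Induction on the columns \<open>S\<close>. If the old columns miss \<open>y\<close>, a
  certificate \<open>c\<close> shows it, and \<open>c\<close> remains valid when it annihilates the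
  new column \<open>e0\<close>. Otherwise \<open>c\<close> can be used to clear column
  \<open>e0\<close> from a certificate for a shifted right-hand side.\<close>

lemma fredholm_alternative:
  fixes a :: "'v \<Rightarrow> 'e \<Rightarrow> real"
  assumes "finite S" "finite T"
  shows "(\<exists>x. (\<forall>e. e \<notin> S \<longrightarrow> x e = 0) \<and> (\<forall>v\<in>T. (\<Sum>e\<in>S. a v e * x e) = y v)) \<or>
    (\<exists>c. (\<forall>e\<in>S. (\<Sum>v\<in>T. c v * a v e) = 0) \<and> (\<Sum>v\<in>T. c v * y v) \<noteq> 0)"
  using assms(1)
proof (induction S arbitrary: y rule: finite_induct)
  case empty
  show ?case
  proof (cases "\<exists>v\<in>T. y v \<noteq> 0")
    case True
    then obtain v where v: "v \<in> T" "y v \<noteq> 0" by blast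
    have "(\<Sum>u\<in>T. of_bool (u = v) * y u) = (\<Sum>u\<in>T. if u = v then y u else 0)"
      by (intro sum.cong) auto
    also have "\<dots> = y v" using v(1) assms(2) by simp
    finally show ?thesis using v by (intro disjI2 exI[of _ "\<lambda>u. of_bool (u = v)"]) auto
  next
    case False
    then show ?thesis by (intro disjI1 exI[of _ "\<lambda>_. 0"]) auto
  qed
next
  case (insert e0 S)
  have upd: "(\<Sum>e\<in>insert e0 S. a v e * (x(e0 := k)) e) = a v e0 * k + (\<Sum>e\<in>S. a v e * x e)"
    for v x k
  proof -
    have "(\<Sum>e\<in>S. a v e * (x(e0 := k)) e) = (\<Sum>e\<in>S. a v e * x e)"
      using insert.hyps(2) by (intro sum.cong) auto
    then show ?thesis using insert.hyps by simp
  qed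
  show ?case
  proof (cases "\<exists>x. (\<forall>e. e \<notin> S \<longrightarrow> x e = 0) \<and> (\<forall>v\<in>T. (\<Sum>e\<in>S. a v e * x e) = y v)")
    case True
    then obtain x where "\<forall>e. e \<notin> S \<longrightarrow> x e = 0" "\<forall>v\<in>T. (\<Sum>e\<in>S. a v e * x e) = y v" by blast
    then show ?thesis using upd[of _ x 0] by (intro disjI1 exI[of _ "x(e0 := 0)"]) auto
  next
    case False
    then obtain c where c: "\<forall>e\<in>S. (\<Sum>v\<in>T. c v * a v e) = 0" "(\<Sum>v\<in>T. c v * y v) \<noteq> 0"
      using insert.IH[of y] by blast
    define p where "p = (\<Sum>v\<in>T. c v * a v e0)"
    show ?thesis
    proof (cases "p = 0")
      case True
      then show ?thesis using c by (intro disjI2 exI[of _ c]) (auto simp: p_def)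
    next
      case p: False
      \<comment> \<open>The only possible coefficient of \<open>e0\<close>: pairing the enlarged
        system with \<open>c\<close> leaves just \<open>p * k\<close> on the left.\<close>
      define k where "k = (\<Sum>v\<in>T. c v * y v) / p"
      define y' where "y' = (\<lambda>v. y v - k * a v e0)"
      from insert.IH[of y'] show ?thesis
      proof (elim disjE exE conjE)
        fix x assume "\<forall>e. e \<notin> S \<longrightarrow> x e = 0" "\<forall>v\<in>T. (\<Sum>e\<in>S. a v e * x e) = y' v"
        then show ?thesis
          using upd[of _ x k] by (intro disjI1 exI[of _ "x(e0 := k)"]) (auto simp: y'_def)
      next
        fix d assume d: "\<forall>e\<in>S. (\<Sum>v\<in>T. d v * a v e) = 0" "(\<Sum>v\<in>T. d v * y' v) \<noteq> 0"
        \<comment> \<open>Chosen so that \<open>d - j c\<close> annihilates column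
          \<open>e0\<close>; its pairing with \<open>y\<close> equals that of \<open>d\<close> with
          \<open>y'\<close>.\<close>
        define j where "j = (\<Sum>v\<in>T. d v * a v e0) / p"
        have lin: "(\<Sum>v\<in>T. (d v - j * c v) * z v) = (\<Sum>v\<in>T. d v * z v) - j * (\<Sum>v\<in>T. c v * z v)" for z
          by (simp add: left_diff_distrib sum_subtractf sum_distrib_left mult.assoc)
        have "(\<Sum>v\<in>T. d v * y' v) = (\<Sum>v\<in>T. d v * y v) - k * (\<Sum>v\<in>T. d v * a v e0)"
          by (simp add: y'_def right_diff_distrib sum_subtractf sum_distrib_left mult.left_commute)
        also have "k * (\<Sum>v\<in>T. d v * a v e0) = j * (\<Sum>v\<in>T. c v * y v)"
          by (simp add: k_def j_def)
        finally have "(\<Sum>v\<in>T. (d v - j * c v) * y v) \<noteq> 0" using d(2) lin by simp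
        moreover have "\<forall>e\<in>insert e0 S. (\<Sum>v\<in>T. (d v - j * c v) * a v e) = 0"
          using c(1) d(1) p unfolding lin by (auto simp: j_def simp flip: p_def)
        ultimately show ?thesis by (intro disjI2 exI[of _ "\<lambda>v. d v - j * c v"]) blast
      qed
    qed
  qed
qed

text \<open>Gaussian elimination row by row: a row with a pivot \<open>e0\<close> uses up one
  column, a row vanishing on \<open>S\<close> uses none, so a free variable is left over.\<close>

lemma homogeneous_system_nontrivial:
  fixes a :: "'v \<Rightarrow> 'e \<Rightarrow> real"
  assumes "finite T" "finite S" "card T < card S"
  shows "\<exists>x. (\<forall>e. e \<notin> S \<longrightarrow> x e = 0) \<and> (\<exists>e\<in>S. x e \<noteq> 0) \<and> (\<forall>v\<in>T. (\<Sum>e\<in>S. a v e * x e) = 0)"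
  using assms
proof (induction T arbitrary: S a rule: finite_induct)
  case empty
  then obtain e where "e \<in> S" by fastforce
  then show ?case by (intro exI[of _ "\<lambda>e'. of_bool (e' = e)"]) auto
next
  case (insert u T)
  show ?case
  proof (cases "\<exists>e\<in>S. a u e \<noteq> 0")
    case False
    have "card T < card S" using insert by simp
    then obtain x where x: "\<forall>e. e \<notin> S \<longrightarrow> x e = 0" "\<exists>e\<in>S. x e \<noteq> 0"
        "\<forall>v\<in>T. (\<Sum>e\<in>S. a v e * x e) = 0"
      using insert.IH[OF insert.prems(1)] by blast
    then show ?thesis using False by (intro exI[of _ x]) auto
  next
    case True
    then obtain e0 where e0: "e0 \<in> S" "a u e0 \<noteq> 0" by blast
    define S' where "S' = S - {e0}"
    have S: "S = insert e0 S'" "e0 \<notin> S'" "finite S'" using e0 insert.prems by (auto simp: S'_def)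
    have "card T < card S'" using insert S by simp
    then obtain x where x: "\<forall>e. e \<notin> S' \<longrightarrow> x e = 0" "\<exists>e\<in>S'. x e \<noteq> 0"
        "\<forall>v\<in>T. (\<Sum>e\<in>S'. (a v e - a u e / a u e0 * a v e0) * x e) = 0"
      using insert.IH[OF S(3), of "\<lambda>v e. a v e - a u e / a u e0 * a v e0"] by blast
    \<comment> \<open>Back substitution: this value of the pivot variable satisfies row
      \<open>u\<close>.\<close>
    define k where "k = - (\<Sum>e\<in>S'. a u e * x e) / a u e0"
    have upd: "(\<Sum>e\<in>S. a v e * (x(e0 := k)) e) = a v e0 * k + (\<Sum>e\<in>S'. a v e * x e)" for v
    proof -
      have "(\<Sum>e\<in>S'. a v e * (x(e0 := k)) e) = (\<Sum>e\<in>S'. a v e * x e)"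
        using S by (intro sum.cong) auto
      then show ?thesis using S by simp
    qed
    have "(\<Sum>e\<in>S'. (a v e - a u e / a u e0 * a v e0) * x e) = (\<Sum>e\<in>S'. a v e * x e) + a v e0 * k" for v
    proof -
      have "(\<Sum>e\<in>S'. (a v e - a u e / a u e0 * a v e0) * x e)
          = (\<Sum>e\<in>S'. a v e * x e - a v e0 / a u e0 * (a u e * x e))"
        by (intro sum.cong) (auto simp: left_diff_distrib)
      also have "\<dots> = (\<Sum>e\<in>S'. a v e * x e) - a v e0 / a u e0 * (\<Sum>e\<in>S'. a u e * x e)"
        unfolding sum_subtractf sum_distrib_left ..
      finally show ?thesis by (simp add: k_def)
    qed
    then have "\<forall>v\<in>T. (\<Sum>e\<in>S. a v e * (x(e0 := k)) e) = 0" using x(3) upd by (auto simp: add.commute)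
    moreover have "(\<Sum>e\<in>S. a u e * (x(e0 := k)) e) = 0" unfolding upd using e0 by (simp add: k_def)
    moreover have "\<exists>e\<in>S. (x(e0 := k)) e \<noteq> 0" using x(2) S by auto
    ultimately show ?thesis using x(1) S by (intro exI[of _ "x(e0 := k)"]) auto
  qed
qed

text \<open>The sets in \<K> are treated one at a time, shifting a single coordinate of
  \<open>b\<close>. Each witness, old or new, forbids at most one shift, while an open interval
  offers infinitely many. The sets will be nontrivial kernels and cokernels, in which one nonzero
  pairing suffices.\<close>

lemma generic_vector:
  fixes lo hi :: real and \<K> :: "('v \<Rightarrow> real) set set"
  assumes "finite \<K>" "finite R" "lo < hi"
    and "\<And>K. K \<in> \<K> \<Longrightarrow> \<exists>c\<in>K. \<exists>v\<in>R. c v \<noteq> 0"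
  shows "\<exists>b. (\<forall>v. lo < b v \<and> b v < hi) \<and> (\<forall>K\<in>\<K>. \<exists>c\<in>K. (\<Sum>v\<in>R. c v * b v) \<noteq> 0)"
  using assms(1,4)
proof (induction \<K> rule: finite_induct)
  case empty
  show ?case using assms(3) by (intro exI[of _ "\<lambda>_. (lo + hi) / 2"]) (auto simp: field_simps)
next
  case (insert K \<K>)
  have "\<exists>b. (\<forall>v. lo < b v \<and> b v < hi) \<and> (\<forall>K\<in>\<K>. \<exists>c\<in>K. (\<Sum>v\<in>R. c v * b v) \<noteq> 0)"
    by (rule insert.IH) (use insert.prems in blast)
  then obtain b where b: "\<And>v. lo < b v" "\<And>v. b v < hi"
      "\<forall>K\<in>\<K>. \<exists>c\<in>K. (\<Sum>v\<in>R. c v * b v) \<noteq> 0" by blast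
  obtain C where C: "\<And>L. L \<in> \<K> \<Longrightarrow> C L \<in> L" "\<And>L. L \<in> \<K> \<Longrightarrow> (\<Sum>v\<in>R. C L v * b v) \<noteq> 0"
    using b(3) by metis
  obtain c u where c: "c \<in> K" "u \<in> R" "c u \<noteq> 0" using insert.prems by blast
  \<comment> \<open>The shifts that make some witness orthogonal to the new vector. A witness
    vanishing at \<open>u\<close> keeps its pairing; its quotient is 0 by convention and merely
    forbids \<open>t = 0\<close>.\<close>
  define bad where "bad = insert (- (\<Sum>v\<in>R. c v * b v) / c u)
    ((\<lambda>L. - (\<Sum>v\<in>R. C L v * b v) / C L u) ` \<K>)"
  have "finite bad" using insert.hyps by (simp add: bad_def)
  moreover have "infinite {lo - b u<..<hi - b u}" using assms(3) by simp
  ultimately have "infinite ({lo - b u<..<hi - b u} - bad)" by (rule Diff_infinite_finite)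
  then obtain t where "t \<in> {lo - b u<..<hi - b u} - bad" using infinite_imp_nonempty by blast
  then have t: "lo - b u < t" "t < hi - b u" "t \<notin> bad" by auto
  define b' where "b' = b(u := b u + t)"
  have dot: "(\<Sum>v\<in>R. d v * b' v) = (\<Sum>v\<in>R. d v * b v) + d u * t" for d
  proof -
    have "(\<Sum>v\<in>R. d v * b' v) = (\<Sum>v\<in>R. d v * b v + (if v = u then d u * t else 0))"
      by (intro sum.cong) (auto simp: b'_def distrib_left)
    then show ?thesis using c(2) assms(2) by (simp add: sum.distrib)
  qed
  have ne: "(\<Sum>v\<in>R. d v * b' v) \<noteq> 0"
    if "(\<Sum>v\<in>R. d v * b v) \<noteq> 0 \<or> d u \<noteq> 0" "t \<noteq> - (\<Sum>v\<in>R. d v * b v) / d u" for d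
    using that unfolding dot by (cases "d u = 0") (auto simp: field_simps eq_neg_iff_add_eq_0)
  have "\<exists>c\<in>L. (\<Sum>v\<in>R. c v * b' v) \<noteq> 0" if "L \<in> insert K \<K>" for L
  proof (cases "L = K")
    case True
    have "t \<noteq> - (\<Sum>v\<in>R. c v * b v) / c u" using t(3) unfolding bad_def by blast
    then show ?thesis using True c ne[of c] by blast
  next
    case False
    then have "L \<in> \<K>" using that by simp
    moreover from this have "t \<noteq> - (\<Sum>v\<in>R. C L v * b v) / C L u"
      using t(3) unfolding bad_def by blast
    ultimately show ?thesis using C[of L] ne[of "C L"] by blast
  qed
  moreover have "lo < b' v \<and> b' v < hi" for v using b t by (auto simp: b'_def)
  ultimately show ?case by (intro exI[of _ b']) blast
qed

section \<open>Sweeping a complex by a value function\<close>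

text \<open>Induction on the number of faces: one collapse leaves a sublevel set of the same kind,
  with \<open>a\<close> lowered to the top value \<open>m\<close>. By \<open>pos\<close>,
  \<open>M {} < m\<close> as long as a nonempty face exists, so the empty face survives to the
  end.\<close>

lemma sweep_collapsible:
  fixes M :: "'b set \<Rightarrow> real" and S :: "'b set \<Rightarrow> 'b set"
  assumes fin: "finite E"
    and mono: "\<And>F G. F \<subseteq> G \<Longrightarrow> G \<subseteq> E \<Longrightarrow> M F \<le> M G"
    and pos: "\<And>F. F \<subseteq> E \<Longrightarrow> F \<noteq> {} \<Longrightarrow> M {} < M F"
    and sub: "\<And>F. F \<subseteq> E \<Longrightarrow> S F \<subseteq> F"
    and val: "\<And>F. F \<subseteq> E \<Longrightarrow> M (S F) = M F"
    and eq: "\<And>F G. F \<subseteq> E \<Longrightarrow> G \<subseteq> E \<Longrightarrow> M F = M G \<Longrightarrow> S F = S G"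
    and un: "\<And>F G. F \<subseteq> E \<Longrightarrow> G \<subseteq> E \<Longrightarrow> M F = M G \<Longrightarrow> M (F \<union> G) = M F"
    and small: "\<And>F. F \<subseteq> E \<Longrightarrow> M F < a \<Longrightarrow> card (S F) \<le> d"
    and a: "M {} < a"
  shows "d_collapsible d {F. F \<subseteq> E \<and> M F < a}"
  using small a
proof (induction "card {F. F \<subseteq> E \<and> M F < a}" arbitrary: a rule: less_induct)
  case less
  let ?X = "{F. F \<subseteq> E \<and> M F < a}"
  have finX: "finite ?X" using fin by simp
  show ?case
  proof (cases "?X = {{}}")
    case True
    then show ?thesis by (simp add: d_collapsible_def)
  next
    case False
    then obtain F0 where F0: "F0 \<in> ?X" "F0 \<noteq> {}" using less.prems(2) by auto
    define m where "m = Max (M ` ?X)"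
    have "m \<in> M ` ?X" unfolding m_def using finX F0 by (intro Max_in) auto
    then obtain F1 where F1: "F1 \<subseteq> E" "M F1 < a" "M F1 = m" by auto
    have le_m: "M F \<le> m" if "F \<subseteq> E" "M F < a" for F
    proof -
      have "M F \<in> M ` ?X" using that by (intro imageI) simp
      then show ?thesis unfolding m_def using finX by (intro Max_ge finite_imageI)
    qed
    have "M {} < m" using pos[of F0] le_m[of F0] F0 by simp
    have S: "S F = S F1" if "F \<subseteq> E" "M F = m" for F using eq[of F F1] that F1 by simp
    have S_E: "S F1 \<subseteq> E" "M (S F1) = m" using sub val F1 by auto
    have S_iff: "S F1 \<subseteq> F \<longleftrightarrow> M F = m" if "F \<subseteq> E" "M F < a" for F
    proof
      assume "S F1 \<subseteq> F"
      then have "m \<le> M F" using mono[of "S F1" F] that S_E by simp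
      then show "M F = m" using le_m[OF that] by simp
    next
      assume "M F = m"
      then show "S F1 \<subseteq> F" using S[of F] sub[of F] that by simp
    qed
    have union_val: "\<Union>\<F> \<subseteq> E \<and> M (\<Union>\<F>) = m"
      if "finite \<F>" "\<F> \<noteq> {}" "\<And>F. F \<in> \<F> \<Longrightarrow> F \<subseteq> E \<and> M F = m" for \<F>
      using that
    proof (induction \<F> rule: finite_ne_induct)
      case (insert F \<F>)
      then have "F \<subseteq> E" "M F = m" "\<Union>\<F> \<subseteq> E" "M (\<Union>\<F>) = m" by blast+
      then show ?case using un[of F "\<Union>\<F>"] by simp
    qed simp
    \<comment> \<open>By \<open>un\<close> the top layer is closed under unions, so \<open>U\<close>
      is its largest member and the only facet that can contain \<open>S F1\<close>.\<close>
    define U where "U = \<Union>{F. F \<subseteq> E \<and> M F = m}"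
    have "U \<subseteq> E \<and> M U = m" unfolding U_def
    proof (rule union_val)
      show "finite {F. F \<subseteq> E \<and> M F = m}" using fin by simp
      show "{F. F \<subseteq> E \<and> M F = m} \<noteq> {}" using F1 by blast
    qed simp
    then have U: "U \<subseteq> E" "M U = m" by blast+
    have U_max: "F \<subseteq> U" if "F \<subseteq> E" "M F = m" for F using that by (auto simp: U_def)
    have "facet ?X U"
      unfolding facet_def
    proof (intro conjI ballI impI)
      show "U \<in> ?X" using U F1 by simp
      fix \<rho> assume "\<rho> \<in> ?X" "U \<subseteq> \<rho>"
      then have "M \<rho> = m" using mono[of U \<rho>] le_m[of \<rho>] U by force
      then show "\<rho> = U" using \<open>\<rho> \<in> ?X\<close> \<open>U \<subseteq> \<rho>\<close> U_max[of \<rho>] by blast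
    qed
    moreover have "S F1 \<subseteq> U" using S_E U_max by simp
    moreover have "\<tau> = U" if "facet ?X \<tau>" "S F1 \<subseteq> \<tau>" for \<tau>
    proof -
      have \<tau>: "\<tau> \<subseteq> E" "M \<tau> < a" "\<forall>\<rho>\<in>?X. \<tau> \<subseteq> \<rho> \<longrightarrow> \<rho> = \<tau>"
        using that(1) by (auto simp: facet_def)
      then have "\<tau> \<subseteq> U" using S_iff[of \<tau>] that(2) U_max by blast
      then show ?thesis using \<tau>(3) U F1 by auto
    qed
    ultimately have uniq: "\<exists>!\<tau>. facet ?X \<tau> \<and> S F1 \<subseteq> \<tau>" by blast
    have Y: "{F. F \<subseteq> E \<and> M F < m} = {\<tau> \<in> ?X. \<not> S F1 \<subseteq> \<tau>}"
    proof (rule set_eqI)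
      fix F
      show "F \<in> {F. F \<subseteq> E \<and> M F < m} \<longleftrightarrow> F \<in> {\<tau> \<in> ?X. \<not> S F1 \<subseteq> \<tau>}"
        using S_iff[of F] le_m[of F] F1(2,3) by (auto simp: order_le_less)
    qed
    have "elementary_collapse d ?X {F. F \<subseteq> E \<and> M F < m}"
      unfolding elementary_collapse_def
    proof (intro bexI[of _ "S F1"] conjI)
      show "S F1 \<in> ?X" using S_E F1 by simp
      show "finite (S F1)" using S_E(1) fin by (rule finite_subset)
      show "card (S F1) \<le> d" using less.prems(1) F1 by simp
    qed (fact uniq Y)+
    moreover have "d_collapsible d {F. F \<subseteq> E \<and> M F < m}"
    proof (rule less.hyps)
      show "card {F. F \<subseteq> E \<and> M F < m} < card ?X"
        using finX F1 by (intro psubset_card_mono) auto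
      show "card (S F) \<le> d" if "F \<subseteq> E" "M F < m" for F using less.prems(1) that F1 by simp
      show "M {} < m" by fact
    qed
    ultimately show ?thesis unfolding d_collapsible_def by (rule converse_rtranclp_into_rtranclp)
  qed
qed

section \<open>Generic linear programs\<close>

locale linear_program =
  fixes R :: "'v set" and C :: "'e set" and A :: "'v \<Rightarrow> 'e \<Rightarrow> real"
  assumes finite_R: "finite R" and finite_C: "finite C"
begin

text \<open>Vectors live on the whole type and vanish off \<open>F\<close>, and rows are summed over
  the fixed \<open>C\<close>. So one vector can be feasible for several \<open>F\<close>, and
  enlarging \<open>F\<close> keeps it feasible.\<close>

definition feasible :: "('v \<Rightarrow> real) \<Rightarrow> 'e set \<Rightarrow> ('e \<Rightarrow> real) \<Rightarrow> bool" where
  "feasible b F x \<longleftrightarrow> (\<forall>e. 0 \<le> x e) \<and> (\<forall>e. e \<notin> F \<longrightarrow> x e = 0) \<and>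
     (\<forall>v\<in>R. (\<Sum>e\<in>C. A v e * x e) \<le> b v)"

definition optimal :: "('v \<Rightarrow> real) \<Rightarrow> ('e \<Rightarrow> real) \<Rightarrow> 'e set \<Rightarrow> ('e \<Rightarrow> real) \<Rightarrow> bool" where
  "optimal b w F x \<longleftrightarrow> feasible b F x \<and>
     (\<forall>y. feasible b F y \<longrightarrow> (\<Sum>e\<in>C. w e * y e) \<le> (\<Sum>e\<in>C. w e * x e))"

definition tight :: "('v \<Rightarrow> real) \<Rightarrow> ('e \<Rightarrow> real) \<Rightarrow> 'v set" where
  "tight b x = {v \<in> R. (\<Sum>e\<in>C. A v e * x e) = b v}"

definition supp :: "('e \<Rightarrow> real) \<Rightarrow> 'e set" where
  "supp x = {e. x e \<noteq> 0}"

definition kernel :: "'v set \<Rightarrow> 'e set \<Rightarrow> ('e \<Rightarrow> real) set" where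
  "kernel T S = {d. (\<forall>e. e \<notin> S \<longrightarrow> d e = 0) \<and> (\<forall>v\<in>T. (\<Sum>e\<in>C. A v e * d e) = 0)}"

text \<open>For \<open>T\<close> inside \<open>R\<close>, this is the left null space of the
  submatrix with rows \<open>T\<close> and columns \<open>S\<close>, extended by zero: the linear
  dependencies among these rows.\<close>

definition cokernel :: "'v set \<Rightarrow> 'e set \<Rightarrow> ('v \<Rightarrow> real) set" where
  "cokernel T S = {c. (\<forall>v. v \<notin> T \<longrightarrow> c v = 0) \<and> (\<forall>e\<in>S. (\<Sum>v\<in>R. c v * A v e) = 0)}"

text \<open>The tight equations determine \<open>x\<close> among vectors with the same support. The
  feasible vectors of this kind are the vertices of the feasible polytope.\<close>

definition basic :: "('v \<Rightarrow> real) \<Rightarrow> ('e \<Rightarrow> real) \<Rightarrow> bool" where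
  "basic b x \<longleftrightarrow> supp x \<subseteq> C \<and> kernel (tight b x) (supp x) \<subseteq> {\<lambda>_. 0}"

text \<open>Genericity of the right-hand side excludes degenerate solutions: a linear dependency among
  the tight rows on the support of \<open>x\<close> would be orthogonal to \<open>b\<close>.\<close>

definition generic_rhs :: "('v \<Rightarrow> real) \<Rightarrow> bool" where
  "generic_rhs b \<longleftrightarrow> (\<forall>T\<subseteq>R. \<forall>S\<subseteq>C. cokernel T S \<subseteq> {\<lambda>_. 0} \<or>
     (\<exists>c\<in>cokernel T S. (\<Sum>v\<in>R. c v * b v) \<noteq> 0))"

text \<open>The first clause will force optima to be basic, the second separates the values of basic
  vectors. As \<open>basic\<close> depends on \<open>b\<close>, the cost is chosen after the
  right-hand side.\<close>

definition generic_cost :: "('v \<Rightarrow> real) \<Rightarrow> ('e \<Rightarrow> real) \<Rightarrow> bool" where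
  "generic_cost b w \<longleftrightarrow>
     (\<forall>T\<subseteq>R. \<forall>S\<subseteq>C. kernel T S \<subseteq> {\<lambda>_. 0} \<or> (\<exists>d\<in>kernel T S. (\<Sum>e\<in>C. w e * d e) \<noteq> 0)) \<and>
     (\<forall>x y. basic b x \<longrightarrow> basic b y \<longrightarrow> (\<Sum>e\<in>C. w e * x e) = (\<Sum>e\<in>C. w e * y e) \<longrightarrow> x = y)"

section \<open>Existence of generic data\<close>

lemma exists_generic_rhs:
  assumes "lo < hi"
  shows "\<exists>b. (\<forall>v. lo < b v \<and> b v < hi) \<and> generic_rhs b"
proof -
  define \<K> where "\<K> = {K \<in> (\<lambda>(T, S). cokernel T S) ` (Pow R \<times> Pow C). \<not> K \<subseteq> {\<lambda>_. 0}}"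
  have "\<exists>b. (\<forall>v. lo < b v \<and> b v < hi) \<and> (\<forall>K\<in>\<K>. \<exists>c\<in>K. (\<Sum>v\<in>R. c v * b v) \<noteq> 0)"
  proof (rule generic_vector)
    show "finite \<K>" unfolding \<K>_def using finite_R finite_C by simp
    fix K assume "K \<in> \<K>"
    then obtain T S c where K: "K = cokernel T S" "T \<subseteq> R" "c \<in> K" "c \<noteq> (\<lambda>_. 0)"
      by (auto simp: \<K>_def)
    then obtain v where "c v \<noteq> 0" by auto
    then have "v \<in> R" using K by (auto simp: cokernel_def)
    then show "\<exists>c\<in>K. \<exists>v\<in>R. c v \<noteq> 0" using K(3) \<open>c v \<noteq> 0\<close> by blast
  qed (use finite_R assms in auto)
  then obtain b where b: "\<forall>v. lo < b v \<and> b v < hi"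
      "\<forall>K\<in>\<K>. \<exists>c\<in>K. (\<Sum>v\<in>R. c v * b v) \<noteq> 0" by blast
  have "cokernel T S \<in> \<K>" if "T \<subseteq> R" "S \<subseteq> C" "\<not> cokernel T S \<subseteq> {\<lambda>_. 0}" for T S
    using that by (auto simp: \<K>_def)
  then have "generic_rhs b" using bspec[OF b(2)] unfolding generic_rhs_def by meson
  with b(1) show ?thesis by blast
qed

text \<open>Two basic vectors with the same tight set and support differ by a kernel element, so
  this pair is an injective code with finitely many values.\<close>

lemma finite_basic: "finite {x. basic b x}"
proof (rule inj_on_finite[of "\<lambda>x. (tight b x, supp x)" _ "Pow R \<times> Pow C"])
  show "inj_on (\<lambda>x. (tight b x, supp x)) {x. basic b x}"
  proof (rule inj_onI, clarsimp)
    fix x y assume xy: "basic b x" "tight b x = tight b y" "supp x = supp y"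
    have "(\<lambda>e. x e - y e) \<in> kernel (tight b x) (supp x)"
      using xy(2,3) by (auto simp: kernel_def supp_def tight_def right_diff_distrib sum_subtractf)
    then have "(\<lambda>e. x e - y e) = (\<lambda>_. 0)" using xy(1) unfolding basic_def by blast
    then have "x e - y e = 0" for e by (rule fun_cong)
    then show "x = y" by (simp add: fun_eq_iff)
  qed
qed (use finite_R finite_C in \<open>auto simp: basic_def tight_def\<close>)

text \<open>Both clauses come from one use of \<open>generic_vector\<close>: its family consists of
  the nontrivial kernels and, for distinct basic vectors, the singletons of their
  differences.\<close>

lemma exists_generic_cost:
  assumes "lo < hi"
  shows "\<exists>w. (\<forall>e. lo < w e \<and> w e < hi) \<and> generic_cost b w"
proof -
  define \<K> where "\<K> = {K \<in> (\<lambda>(T, S). kernel T S) ` (Pow R \<times> Pow C). \<not> K \<subseteq> {\<lambda>_. 0}} \<union>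
    (\<lambda>(x, y). {\<lambda>e. x e - y e}) ` {(x, y) \<in> {x. basic b x} \<times> {x. basic b x}. x \<noteq> y}"
  have "\<exists>w. (\<forall>e. lo < w e \<and> w e < hi) \<and> (\<forall>K\<in>\<K>. \<exists>d\<in>K. (\<Sum>e\<in>C. d e * w e) \<noteq> 0)"
  proof (rule generic_vector)
    have "finite {(x, y) \<in> {x. basic b x} \<times> {x. basic b x}. x \<noteq> y}"
      by (rule finite_subset[of _ "{x. basic b x} \<times> {x. basic b x}"]) (auto simp: finite_basic)
    then show "finite \<K>" unfolding \<K>_def using finite_R finite_C by simp
    fix K assume "K \<in> \<K>"
    then consider T S d where "K = kernel T S" "S \<subseteq> C" "d \<in> K" "d \<noteq> (\<lambda>_. 0)"
      | x y where "basic b x" "basic b y" "x \<noteq> y" "K = {\<lambda>e. x e - y e}"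
      by (auto simp: \<K>_def)
    then obtain d where d: "d \<in> K" "d \<noteq> (\<lambda>_. 0)" "\<And>e. e \<notin> C \<Longrightarrow> d e = 0"
    proof cases
      case 1
      then have "d e = 0" if "e \<notin> C" for e using that by (auto simp: kernel_def)
      then show thesis using that 1 by blast
    next
      case 2
      have "x e = 0" "y e = 0" if "e \<notin> C" for e using 2 that unfolding basic_def supp_def by blast+
      then have "\<And>e. e \<notin> C \<Longrightarrow> x e - y e = 0" by simp
      then show thesis using that[of "\<lambda>e. x e - y e"] 2 by (auto simp: fun_eq_iff)
    qed
    then show "\<exists>d\<in>K. \<exists>e\<in>C. d e \<noteq> 0" by blast
  qed (use finite_C assms in auto)
  then obtain w where w: "\<forall>e. lo < w e \<and> w e < hi"
      "\<forall>K\<in>\<K>. \<exists>d\<in>K. (\<Sum>e\<in>C. w e * d e) \<noteq> 0" by (auto simp: mult.commute)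
  have "kernel T S \<in> \<K>" if "T \<subseteq> R" "S \<subseteq> C" "\<not> kernel T S \<subseteq> {\<lambda>_. 0}" for T S
    using that by (auto simp: \<K>_def)
  moreover have "x = y"
    if "basic b x" "basic b y" "(\<Sum>e\<in>C. w e * x e) = (\<Sum>e\<in>C. w e * y e)" for x y
  proof (rule ccontr)
    assume "x \<noteq> y"
    then have "{\<lambda>e. x e - y e} \<in> \<K>" using that(1,2) by (auto simp: \<K>_def)
    then show False using w(2) that(3) by (auto simp: right_diff_distrib sum_subtractf)
  qed
  ultimately have "generic_cost b w" using bspec[OF w(2)] unfolding generic_cost_def by meson
  with w(1) show ?thesis by blast
qed

section \<open>Feasible directions and basic optima\<close>

text \<open>Constraints that are strict at \<open>x\<close> survive a small step, the active ones
  are guarded by the sign conditions on \<open>d\<close>, and finitely many constraints admit a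
  common step.\<close>

lemma feasible_direction:
  assumes x: "feasible b F x" and "F \<subseteq> C"
    and d: "\<And>e. e \<notin> F \<Longrightarrow> d e = 0" "\<And>e. x e = 0 \<Longrightarrow> 0 \<le> d e"
      "\<And>v. v \<in> tight b x \<Longrightarrow> (\<Sum>e\<in>C. A v e * d e) \<le> 0"
  shows "\<exists>t>0. feasible b F (\<lambda>e. x e + t * d e)"
proof -
  have lim: "((\<lambda>t. p + t * q) \<longlongrightarrow> p) (at_right 0)" for p q :: real
  proof -
    have "((\<lambda>t. p + t * q) \<longlongrightarrow> p + 0 * q) (at_right 0)" by (intro tendsto_intros)
    then show ?thesis by simp
  qed
  have gt0: "\<forall>\<^sub>F t in at_right (0::real). 0 < t" by (rule eventually_at_right_less)
  have "\<forall>\<^sub>F t in at_right 0. 0 \<le> x e + t * d e" for e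
  proof (cases "x e = 0")
    case True
    then show ?thesis using gt0 d(2)[of e] by (auto elim!: eventually_mono)
  next
    case False
    then have "0 < x e" using x by (metis feasible_def order_le_less)
    then show ?thesis
      using order_tendstoD(1)[OF lim[of "x e" "d e"], of 0] by (auto elim!: eventually_mono)
  qed
  then have nonneg: "\<forall>\<^sub>F t in at_right 0. \<forall>e\<in>C. 0 \<le> x e + t * d e"
    by (intro eventually_ball_finite finite_C) blast
  have dot: "(\<Sum>e\<in>C. A v e * (x e + t * d e)) = (\<Sum>e\<in>C. A v e * x e) + t * (\<Sum>e\<in>C. A v e * d e)" for v t
    by (simp add: distrib_left sum.distrib sum_distrib_left mult.left_commute)
  have "\<forall>\<^sub>F t in at_right 0. (\<Sum>e\<in>C. A v e * (x e + t * d e)) \<le> b v" if "v \<in> R" for v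
  proof (cases "v \<in> tight b x")
    case True
    then show ?thesis unfolding dot using gt0 d(3)[OF True]
      by (auto simp: tight_def mult_nonneg_nonpos elim!: eventually_mono)
  next
    case False
    then have "(\<Sum>e\<in>C. A v e * x e) < b v"
      using x that by (auto simp: feasible_def tight_def order_le_less)
    from order_tendstoD(2)[OF lim this, of "\<Sum>e\<in>C. A v e * d e"]
    show ?thesis unfolding dot by (rule eventually_mono) simp
  qed
  then have "\<forall>\<^sub>F t in at_right 0. \<forall>v\<in>R. (\<Sum>e\<in>C. A v e * (x e + t * d e)) \<le> b v"
    by (intro eventually_ball_finite finite_R) blast
  with gt0 nonneg have "\<forall>\<^sub>F t in at_right 0. 0 < t \<and> (\<forall>e\<in>C. 0 \<le> x e + t * d e) \<and>
      (\<forall>v\<in>R. (\<Sum>e\<in>C. A v e * (x e + t * d e)) \<le> b v)"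
    by eventually_elim blast
  then obtain t where t: "0 < t" "\<forall>e\<in>C. 0 \<le> x e + t * d e"
      "\<forall>v\<in>R. (\<Sum>e\<in>C. A v e * (x e + t * d e)) \<le> b v"
    using eventually_happens'[OF trivial_limit_at_right_real] by blast
  have "x e + t * d e = 0" if "e \<notin> F" for e using that x d(1) by (simp add: feasible_def)
  then have "feasible b F (\<lambda>e. x e + t * d e)"
    using t \<open>F \<subseteq> C\<close> unfolding feasible_def by (metis order_refl subsetD)
  with t(1) show ?thesis by blast
qed

lemma optimal_direction:
  assumes x: "optimal b w F x" and "F \<subseteq> C"
    and d: "\<And>e. e \<notin> F \<Longrightarrow> d e = 0" "\<And>e. x e = 0 \<Longrightarrow> 0 \<le> d e"
      "\<And>v. v \<in> tight b x \<Longrightarrow> (\<Sum>e\<in>C. A v e * d e) \<le> 0"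
  shows "(\<Sum>e\<in>C. w e * d e) \<le> 0"
proof -
  obtain t where t: "t > 0" "feasible b F (\<lambda>e. x e + t * d e)"
    using feasible_direction[of b F x d] assms by (auto simp: optimal_def)
  then have "(\<Sum>e\<in>C. w e * (x e + t * d e)) \<le> (\<Sum>e\<in>C. w e * x e)"
    using x by (simp add: optimal_def)
  then have "t * (\<Sum>e\<in>C. w e * d e) \<le> 0"
    by (simp add: distrib_left sum.distrib sum_distrib_left mult.left_commute)
  then show ?thesis using t(1) by (simp add: mult_le_0_iff)
qed

text \<open>A kernel vector of the tight rows on the support may be followed in both directions, so
  optimality makes its cost zero; genericity supplies one of nonzero cost if the kernel is
  nontrivial.\<close>

lemma optimal_basic:
  assumes w: "generic_cost b w" and x: "optimal b w F x" and F: "F \<subseteq> C"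
  shows "basic b x"
proof -
  have supp: "supp x \<subseteq> F" using x by (auto simp: supp_def optimal_def feasible_def)
  have "kernel (tight b x) (supp x) \<subseteq> {\<lambda>_. 0}"
  proof (rule ccontr)
    assume "\<not> ?thesis"
    moreover have "tight b x \<subseteq> R" "supp x \<subseteq> C" using supp F by (auto simp: tight_def)
    ultimately obtain d where d: "d \<in> kernel (tight b x) (supp x)" "(\<Sum>e\<in>C. w e * d e) \<noteq> 0"
      using w unfolding generic_cost_def by blast
    have d0: "d e = 0" if "x e = 0" for e using d(1) that by (simp add: kernel_def supp_def)
    have dF: "d e = 0" if "e \<notin> F" for e using d(1) that supp by (auto simp: kernel_def)
    have dT: "(\<Sum>e\<in>C. A v e * d e) = 0" if "v \<in> tight b x" for v
      using d(1) that by (simp add: kernel_def)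
    have "(\<Sum>e\<in>C. w e * d e) \<le> 0" by (rule optimal_direction[OF x F]) (simp_all add: d0 dF dT)
    moreover have "(\<Sum>e\<in>C. w e * - d e) \<le> 0"
      by (rule optimal_direction[OF x F]) (simp_all add: d0 dF dT sum_negf)
    ultimately show False using d(2) by (simp add: sum_negf)
  qed
  then show ?thesis using supp F by (simp add: basic_def)
qed

lemma sum_supp:
  fixes f x :: "'e \<Rightarrow> real"
  assumes "S \<subseteq> C" "\<And>e. e \<notin> S \<Longrightarrow> x e = 0"
  shows "(\<Sum>e\<in>C. f e * x e) = (\<Sum>e\<in>S. f e * x e)"
  using assms finite_C by (intro sum.mono_neutral_right) auto

text \<open>With more support columns than tight rows, the homogeneous system would have a nonzero
  kernel vector.\<close>

lemma basic_card_le: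
  assumes "basic b x"
  shows "card (supp x) \<le> card (tight b x)"
proof (rule ccontr)
  have S: "supp x \<subseteq> C" and fin: "finite (supp x)" "finite (tight b x)"
    using assms finite_C finite_R by (auto simp: basic_def tight_def intro: finite_subset)
  assume "\<not> ?thesis"
  then obtain d where d: "\<forall>e. e \<notin> supp x \<longrightarrow> d e = 0" "\<exists>e\<in>supp x. d e \<noteq> 0"
      "\<forall>v\<in>tight b x. (\<Sum>e\<in>supp x. A v e * d e) = 0"
    using homogeneous_system_nontrivial[OF fin(2,1), of A] by auto
  then have "d \<in> kernel (tight b x) (supp x)" using sum_supp[OF S, of d] by (simp add: kernel_def)
  then show False using assms d(2) by (auto simp: basic_def)
qed

section \<open>Nondegeneracy and unions of edge sets\<close>

text \<open>Otherwise the tight rows are dependent on the support, and genericity gives a dependency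
  not orthogonal to \<open>b\<close>. But on tight rows \<open>b\<close> equals \<open>A x\<close>,
  and a dependency annihilates all columns in the support of \<open>x\<close>.\<close>

lemma generic_rhs_solvable:
  assumes b: "generic_rhs b" and S: "supp x \<subseteq> C"
  shows "\<exists>z. (\<forall>e. e \<notin> supp x \<longrightarrow> z e = 0) \<and> (\<forall>v\<in>tight b x. (\<Sum>e\<in>C. A v e * z e) = y v)"
proof (rule ccontr)
  have T: "tight b x \<subseteq> R" by (auto simp: tight_def)
  have fin: "finite (supp x)" "finite (tight b x)"
    using S T finite_C finite_R by (auto intro: finite_subset)
  assume no: "\<not> ?thesis"
  have "\<not> (\<exists>z. (\<forall>e. e \<notin> supp x \<longrightarrow> z e = 0) \<and> (\<forall>v\<in>tight b x. (\<Sum>e\<in>supp x. A v e * z e) = y v))"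
  proof
    assume "\<exists>z. (\<forall>e. e \<notin> supp x \<longrightarrow> z e = 0) \<and> (\<forall>v\<in>tight b x. (\<Sum>e\<in>supp x. A v e * z e) = y v)"
    then obtain z where z: "\<forall>e. e \<notin> supp x \<longrightarrow> z e = 0"
        "\<forall>v\<in>tight b x. (\<Sum>e\<in>supp x. A v e * z e) = y v"
      by blast
    have "(\<Sum>e\<in>C. A v e * z e) = (\<Sum>e\<in>supp x. A v e * z e)" for v
      by (rule sum_supp[OF S]) (simp add: z(1))
    with z have "(\<forall>e. e \<notin> supp x \<longrightarrow> z e = 0) \<and> (\<forall>v\<in>tight b x. (\<Sum>e\<in>C. A v e * z e) = y v)" by simp
    with no show False by blast
  qed
  then obtain c where c: "\<forall>e\<in>supp x. (\<Sum>v\<in>tight b x. c v * A v e) = 0"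
      "(\<Sum>v\<in>tight b x. c v * y v) \<noteq> 0"
    using fredholm_alternative[OF fin, of A y] by blast
  define c' where "c' = (\<lambda>v. if v \<in> tight b x then c v else 0)"
  have c'_sum: "(\<Sum>v\<in>R. c' v * f v) = (\<Sum>v\<in>tight b x. c v * f v)" for f
    using T finite_R by (intro sum.mono_neutral_cong_right) (auto simp: c'_def)
  have "c' \<in> cokernel (tight b x) (supp x)"
    using c(1) c'_sum by (simp add: cokernel_def c'_def)
  moreover have "c' \<noteq> (\<lambda>_. 0)"
  proof
    assume "c' = (\<lambda>_. 0)"
    then have "(\<Sum>v\<in>R. c' v * y v) = 0" by simp
    then show False using c(2) c'_sum by simp
  qed
  ultimately obtain h where h: "h \<in> cokernel (tight b x) (supp x)" "(\<Sum>v\<in>R. h v * b v) \<noteq> 0"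
    using b T S unfolding generic_rhs_def by blast
  have "(\<Sum>v\<in>R. h v * b v) = (\<Sum>v\<in>R. h v * (\<Sum>e\<in>C. A v e * x e))"
    using h(1) by (intro sum.cong) (auto simp: cokernel_def tight_def)
  also have "\<dots> = (\<Sum>e\<in>C. (\<Sum>v\<in>R. h v * A v e) * x e)"
    by (simp add: sum_distrib_left sum_distrib_right mult.assoc) (rule sum.swap)
  also have "\<dots> = 0"
    using h(1) by (intro sum.neutral) (auto simp: cokernel_def supp_def)
  finally show False using h(2) by simp
qed

text \<open>Nondegeneracy is what makes this true: a direction for the union may respect the tight
  rows although neither of its parts does, and only a correction on the common support repairs both
  parts.\<close>

lemma optimal_Un:
  assumes b: "generic_rhs b" and x: "optimal b w F x" "optimal b w G x"
    and FG: "F \<subseteq> C" "G \<subseteq> C"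
  shows "optimal b w (F \<union> G) x"
  unfolding optimal_def
proof (intro conjI allI impI)
  have feas: "feasible b F x" "feasible b G x" using x by (auto simp: optimal_def)
  then show "feasible b (F \<union> G) x" by (auto simp: feasible_def)
  have S: "supp x \<subseteq> F" "supp x \<subseteq> G" using feas by (auto simp: feasible_def supp_def)
  fix y assume y: "feasible b (F \<union> G) y"
  \<comment> \<open>The direction \<open>d\<close> towards \<open>y\<close> splits into feasible directions for \<open>F\<close> and for \<open>G\<close>;
    \<open>z\<close> is a correction on the support of \<open>x\<close> that keeps the tight rows tight.\<close>
  define d where "d = (\<lambda>e. y e - x e)"
  define d1 where "d1 = (\<lambda>e. if e \<in> F \<and> e \<notin> supp x then d e else 0)"
  obtain z where z: "\<And>e. e \<notin> supp x \<Longrightarrow> z e = 0"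
      "\<And>v. v \<in> tight b x \<Longrightarrow> (\<Sum>e\<in>C. A v e * z e) = - (\<Sum>e\<in>C. A v e * d1 e)"
    using generic_rhs_solvable[OF b, of x "\<lambda>v. - (\<Sum>e\<in>C. A v e * d1 e)"] S(1) FG(1) by blast
  have d_nonneg: "0 \<le> d e" if "x e = 0" for e using that y by (simp add: d_def feasible_def)
  have d_tight: "(\<Sum>e\<in>C. A v e * d e) \<le> 0" if "v \<in> tight b x" for v
    using that y by (auto simp: d_def feasible_def tight_def right_diff_distrib sum_subtractf)
  have d_zero: "d e = 0" if "e \<notin> F" "e \<notin> G" for e
    using that y feas by (simp add: d_def feasible_def)
  have z0: "z e = 0" if "x e = 0" for e using z(1)[of e] that by (simp add: supp_def)
  have "(\<Sum>e\<in>C. w e * (d1 e + z e)) \<le> 0"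
  proof (rule optimal_direction[OF x(1) FG(1)])
    show "d1 e + z e = 0" if "e \<notin> F" for e
    proof -
      have "z e = 0" using that z(1) S(1) by blast
      then show ?thesis using that by (simp add: d1_def)
    qed
    show "0 \<le> d1 e + z e" if "x e = 0" for e using that d_nonneg z0 by (simp add: d1_def)
    show "(\<Sum>e\<in>C. A v e * (d1 e + z e)) \<le> 0" if "v \<in> tight b x" for v
      using z(2)[OF that] by (simp add: distrib_left sum.distrib)
  qed
  \<comment> \<open>Since \<open>d1 + z\<close> is zero on the tight rows, the remainder has the
    same row values there as \<open>d\<close>; off \<open>G\<close> it vanishes because
    \<open>d1\<close> has absorbed the edges that lie only in \<open>F\<close>.\<close>
  moreover have "(\<Sum>e\<in>C. w e * (d e - (d1 e + z e))) \<le> 0"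
  proof (rule optimal_direction[OF x(2) FG(2)])
    show "d e - (d1 e + z e) = 0" if "e \<notin> G" for e
    proof -
      have "z e = 0" using that z(1) S(2) by blast
      then show ?thesis using that S(2) d_zero[of e] by (auto simp: d1_def)
    qed
    show "0 \<le> d e - (d1 e + z e)" if "x e = 0" for e
      using that d_nonneg z0 by (simp add: d1_def)
    show "(\<Sum>e\<in>C. A v e * (d e - (d1 e + z e))) \<le> 0" if "v \<in> tight b x" for v
      using z(2)[OF that] d_tight[OF that]
      by (simp add: distrib_left right_diff_distrib sum.distrib sum_subtractf)
  qed
  ultimately have "(\<Sum>e\<in>C. w e * d e) \<le> 0" by (simp add: right_diff_distrib sum_subtractf)
  then show "(\<Sum>e\<in>C. w e * y e) \<le> (\<Sum>e\<in>C. w e * x e)"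
    by (simp add: d_def right_diff_distrib sum_subtractf)
qed

text \<open>Compactness: the bound \<open>B\<close> confines feasible vectors to a product of
  compact intervals, and nonnegative capacities make the zero vector feasible.\<close>

lemma optimal_exists:
  assumes "\<And>v. v \<in> R \<Longrightarrow> 0 \<le> b v" and bound: "\<And>x e. feasible b F x \<Longrightarrow> x e \<le> B"
  shows "\<exists>x. optimal b w F x"
proof -
  define P where "P = (\<Pi>\<^sub>E e\<in>UNIV. if e \<in> F then {0..B} else {0})"
  define K where "K = P \<inter> {x. \<forall>v\<in>R. (\<Sum>e\<in>C. A v e * x e) \<le> b v}"
  have K_iff: "x \<in> K \<longleftrightarrow> feasible b F x" for x
  proof
    show "feasible b F x" if "x \<in> K"
    proof -
      have "x \<in> P" using that by (simp add: K_def)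
      then have box: "x e \<in> (if e \<in> F then {0..B} else {0})" for e
        unfolding P_def by (rule PiE_mem) simp
      have "0 \<le> x e" for e using box[of e] by (cases "e \<in> F") simp_all
      moreover have "x e = 0" if "e \<notin> F" for e using box[of e] that by simp
      ultimately show ?thesis using \<open>x \<in> K\<close> by (simp add: feasible_def K_def)
    qed
    show "x \<in> K" if "feasible b F x"
      using that bound[OF that] by (auto simp: K_def P_def PiE_iff feasible_def)
  qed
  have "compactin (product_topology (\<lambda>_::'e. euclidean) UNIV) P"
    unfolding P_def by (subst compactin_PiE) auto
  then have "compact P" by (simp add: euclidean_product_topology)
  moreover have "closed {x. \<forall>v\<in>R. (\<Sum>e\<in>C. A v e * x e) \<le> b v}"
    unfolding Collect_ball_eq
    by (intro closed_INT ballI closed_Collect_le continuous_intros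
        continuous_on_sum continuous_on_product_coordinates)
  ultimately have "compact K" unfolding K_def by (rule compact_Int_closed)
  moreover have "(\<lambda>_. 0) \<in> K" using assms(1) by (simp add: K_iff feasible_def)
  moreover have "continuous_on K (\<lambda>x. \<Sum>e\<in>C. w e * x e)"
    by (intro continuous_intros continuous_on_sum continuous_on_subset[OF continuous_on_product_coordinates]) auto
  ultimately obtain x where "x \<in> K" "\<And>y. y \<in> K \<Longrightarrow> (\<Sum>e\<in>C. w e * y e) \<le> (\<Sum>e\<in>C. w e * x e)"
    using continuous_attains_sup[of K "\<lambda>x. \<Sum>e\<in>C. w e * x e"] by blast
  then show ?thesis unfolding optimal_def K_iff by blast
qed

end

section \<open>Perturbed fractional matchings\<close>

theorem theorem11:
  fixes r :: nat and V :: "'a set" and E :: "'a set set" and n :: rat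
  assumes "r \<ge> 2" and "uniform_hypergraph r V E" and "n > 1"
  shows "d_collapsible (nat (\<lceil>of_nat r * n\<rceil> - 1)) (fractional_matching_complex E n)"
proof -
  define N where "N = (of_rat n :: real)"
  have N: "N > 1" using assms(3) by (simp add: N_def)
  have V: "finite V" "\<And>e. e \<in> E \<Longrightarrow> e \<subseteq> V" "\<And>e. e \<in> E \<Longrightarrow> card e = r"
    using assms(2) by (auto simp: uniform_hypergraph_def)
  have E: "finite E" using assms(2) by (rule uniform_hypergraph_finite)
  have fin: "finite F" "{} \<notin> F" if "F \<subseteq> E" for F
    using that E V(3)[of "{}"] assms(1) by (auto intro: finite_subset)
  let ?\<nu> = "fractional_matching_number :: 'a set set \<Rightarrow> real"
  let ?X = "fractional_matching_complex E n"
  have X: "?X = {F. F \<subseteq> E \<and> ?\<nu> F < N}" by (simp add: fractional_matching_complex_def N_def)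
  have nu_empty: "?\<nu> {} = 0" using fractional_matching_number_attained[of "{}"] by auto
  \<comment> \<open>There are finitely many faces, so their values stay below \<open>N\<close> by a
    positive gap.\<close>
  define \<mu> where "\<mu> = Max (?\<nu> ` ?X)"
  have finX: "finite ?X" unfolding X using E by simp
  have "\<mu> \<in> ?\<nu> ` ?X"
    unfolding \<mu>_def
  proof (rule Max_in)
    have "{} \<in> ?X" using nu_empty N by (simp add: X)
    then show "?\<nu> ` ?X \<noteq> {}" by blast
  qed (use finX in simp)
  then have "\<mu> < N" by (auto simp: X)
  have nu_le: "?\<nu> F \<le> \<mu>" if "F \<in> ?X" for F unfolding \<mu>_def using finX that by (intro Max_ge) auto
  have "0 \<le> \<mu>" using nu_le[of "{}"] nu_empty N by (simp add: X)
  \<comment> \<open>Capacities and weights in \<open>(q, 1)\<close> change optimal values by a factor at least \<open>q\<^sup>2\<close>, too little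
    to bridge the gap between \<open>\<mu>\<close> and \<open>N\<close>.\<close>
  define q where "q = sqrt ((\<mu> + N) / (2 * N))"
  have "0 < (\<mu> + N) / (2 * N)" "(\<mu> + N) / (2 * N) < 1"
    using \<open>\<mu> < N\<close> \<open>0 \<le> \<mu>\<close> N by (auto simp: field_simps)
  then have q: "0 < q" "q < 1" and q2: "q\<^sup>2 = (\<mu> + N) / (2 * N)" by (auto simp: q_def)
  \<comment> \<open>The choice of \<open>q\<close> puts this threshold at the midpoint of \<mu> and
    \<open>N\<close>.\<close>
  have \<mu>q: "\<mu> < q\<^sup>2 * N" using \<open>\<mu> < N\<close> N by (simp add: q2)
  define A where "A = (\<lambda>(v :: 'a) e. of_bool (v \<in> e) :: real)"
  interpret linear_program V E A by unfold_locales (fact V(1) E)+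
  obtain b where b: "\<And>v. q < b v" "\<And>v. b v < 1" "generic_rhs b"
    using exists_generic_rhs[OF q(2)] by blast
  obtain w where w: "\<And>e. q < w e" "\<And>e. w e < 1" "generic_cost b w"
    using exists_generic_cost[OF q(2), of b] by blast
  have A_sum: "(\<Sum>e\<in>E. A v e * x e) = (\<Sum>e | e \<in> F \<and> v \<in> e. x e)"
    if "F \<subseteq> E" "\<And>e. e \<notin> F \<Longrightarrow> x e = 0" for F x v
    using that E by (intro sum.mono_neutral_cong_right) (auto simp: A_def)
  have E_sum: "(\<Sum>e\<in>E. g e * x e) = (\<Sum>e\<in>F. g e * x e)"
    if "F \<subseteq> E" "\<And>e. e \<notin> F \<Longrightarrow> x e = 0" for F and g x :: "'a set \<Rightarrow> real"
    using that by (rule sum_supp)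
  have matching: "fractional_matching F x" if "F \<subseteq> E" "feasible b F x" for F x
    unfolding fractional_matching_def
  proof (intro conjI ballI allI)
    show "0 \<le> x e" for e using that(2) by (simp add: feasible_def)
    fix v
    show "(\<Sum>e | e \<in> F \<and> v \<in> e. x e) \<le> 1"
    proof (cases "v \<in> V")
      case True
      then have "(\<Sum>e\<in>E. A v e * x e) \<le> b v" using that(2) by (simp add: feasible_def)
      then show ?thesis using A_sum[OF that(1), of x v] that(2) b(2)[of v] by (simp add: feasible_def)
    next
      case False
      then have "{e. e \<in> F \<and> v \<in> e} = {}" using that(1) V(2) by blast
      then show ?thesis by (metis sum.empty zero_le_one)
    qed
  qed
  have feas_nonneg: "0 \<le> x e" and feas_zero: "e \<notin> F \<Longrightarrow> x e = 0" if "feasible b F x" for F x e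
    using that by (auto simp: feasible_def)
  have total_le: "(\<Sum>e\<in>E. x e) \<le> ?\<nu> F" if "F \<subseteq> E" "feasible b F x" for F x
  proof -
    have "(\<Sum>e\<in>E. x e) = (\<Sum>e\<in>F. x e)"
      using E_sum[OF that(1), of x "\<lambda>_. 1"] feas_zero[OF that(2)] by simp
    then show ?thesis
      using fractional_matching_number_upper[OF fin[OF that(1)] matching[OF that]] by simp
  qed
  have bound: "x e \<le> 1" if "F \<subseteq> E" "feasible b F x" for F x e
    using fractional_matching_le_1[OF fin[OF that(1)] matching[OF that]] feas_zero[OF that(2)]
    by (cases "e \<in> F") auto
  have b0: "0 \<le> b v" for v using b(1)[of v] q(1) by simp
  have w0: "0 \<le> w e" for e using w(1)[of e] q(1) by simp
  have "\<exists>x. optimal b w F x" if "F \<subseteq> E" for F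
    using b0 bound[OF that] by (rule optimal_exists)
  then obtain opt where opt: "\<And>F. F \<subseteq> E \<Longrightarrow> optimal b w F (opt F)" by metis
  then have opt_feas: "\<And>F. F \<subseteq> E \<Longrightarrow> feasible b F (opt F)"
    and opt_max: "\<And>F y. F \<subseteq> E \<Longrightarrow> feasible b F y \<Longrightarrow> (\<Sum>e\<in>E. w e * y e) \<le> (\<Sum>e\<in>E. w e * opt F e)"
    unfolding optimal_def by blast+
  define M where "M = (\<lambda>F. \<Sum>e\<in>E. w e * opt F e)"
  have M_upper: "M F \<le> ?\<nu> F" if "F \<subseteq> E" for F
  proof -
    have "M F \<le> (\<Sum>e\<in>E. opt F e)"
      unfolding M_def using less_imp_le[OF w(2)] w0 feas_nonneg[OF opt_feas[OF that]]
      by (intro sum_mono mult_left_le_one_le)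
    also have "\<dots> \<le> ?\<nu> F" using that opt_feas[OF that] by (rule total_le)
    finally show ?thesis .
  qed
  have M_lower: "q\<^sup>2 * (\<Sum>e\<in>F. f e) \<le> M F" if "F \<subseteq> E" "fractional_matching F f" for F f
  proof -
    \<comment> \<open>Scaling by \<open>q\<close> fits a fractional matching into the capacities;
      weights above \<open>q\<close> cost a second factor.\<close>
    define x where "x = (\<lambda>e. if e \<in> F then q * f e else 0)"
    have x0: "e \<notin> F \<Longrightarrow> x e = 0" for e by (simp add: x_def)
    have x_nonneg: "0 \<le> x e" for e using that(2) q(1) by (simp add: x_def fractional_matching_def)
    have "feasible b F x"
      unfolding feasible_def
    proof (intro conjI allI ballI impI)
      fix v
      have "(\<Sum>e\<in>E. A v e * x e) = (\<Sum>e | e \<in> F \<and> v \<in> e. x e)" using that(1) x0 by (rule A_sum)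
      also have "\<dots> = q * (\<Sum>e | e \<in> F \<and> v \<in> e. f e)"
        unfolding sum_distrib_left by (intro sum.cong) (auto simp: x_def)
      also have "\<dots> \<le> q" using that(2) q(1) by (simp add: fractional_matching_def)
      also have "\<dots> \<le> b v" using b(1) by (simp add: less_imp_le)
      finally show "(\<Sum>e\<in>E. A v e * x e) \<le> b v" .
    qed (fact x_nonneg x0)+
    then have "(\<Sum>e\<in>E. w e * x e) \<le> M F" unfolding M_def using opt_max[OF that(1)] by blast
    moreover have "q * (\<Sum>e\<in>E. x e) \<le> (\<Sum>e\<in>E. w e * x e)"
      unfolding sum_distrib_left using less_imp_le[OF w(1)] x_nonneg by (intro sum_mono mult_right_mono)
    moreover have "(\<Sum>e\<in>E. x e) = q * (\<Sum>e\<in>F. f e)"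
    proof -
      have "(\<Sum>e\<in>E. x e) = (\<Sum>e\<in>F. x e)" using E_sum[OF that(1), of x "\<lambda>_. 1"] x0 by simp
      then show ?thesis by (simp add: x_def sum_distrib_left)
    qed
    ultimately show ?thesis by (simp add: power2_eq_square mult.assoc)
  qed
  \<comment> \<open>On faces the perturbed value is at most \<mu>, below the threshold; conversely
    \<open>M F\<close> is at least \<open>q\<^sup>2\<close> times the fractional matching
    number.\<close>
  have X_M: "?X = {F. F \<subseteq> E \<and> M F < q\<^sup>2 * N}"
  proof (rule set_eqI, rule iffI)
    fix F assume F: "F \<in> ?X"
    then have "F \<subseteq> E" by (simp add: X)
    then show "F \<in> {F. F \<subseteq> E \<and> M F < q\<^sup>2 * N}" using M_upper[of F] nu_le[OF F] \<mu>q by simp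
  next
    fix F assume "F \<in> {F. F \<subseteq> E \<and> M F < q\<^sup>2 * N}"
    then have F: "F \<subseteq> E" "M F < q\<^sup>2 * N" by auto
    obtain f where "fractional_matching F f" "(\<Sum>e\<in>F. f e) = ?\<nu> F"
      using fractional_matching_number_attained[OF fin[OF F(1)]] by blast
    then have "q\<^sup>2 * ?\<nu> F < q\<^sup>2 * N" using M_lower[OF F(1), of f] F(2) by simp
    then show "F \<in> ?X" using F(1) q(1) by (simp add: X)
  qed
  have supp_sub: "supp (opt F) \<subseteq> F" if "F \<subseteq> E" for F
    using feas_zero[OF opt_feas[OF that]] by (auto simp: supp_def)
  have M_mono: "M F \<le> M G" if "F \<subseteq> G" "G \<subseteq> E" for F G
  proof -
    have "feasible b F (opt F)" using that by (intro opt_feas) blast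
    then have "feasible b G (opt F)" using that(1) unfolding feasible_def by blast
    then show ?thesis unfolding M_def using opt_max[OF that(2)] by blast
  qed
  have opt_eq: "opt F = opt G" if "F \<subseteq> E" "G \<subseteq> E" "M F = M G" for F G
    using w(3) optimal_basic[OF w(3) opt[OF that(1)] that(1)]
      optimal_basic[OF w(3) opt[OF that(2)] that(2)] that(3)
    unfolding generic_cost_def M_def by blast
  show ?thesis
    unfolding X_M
  proof (rule sweep_collapsible[where S = "\<lambda>F. supp (opt F)"])
    show "finite E" by fact
    show "M F \<le> M G" if "F \<subseteq> G" "G \<subseteq> E" for F G using that by (rule M_mono)
    have M_empty: "M {} \<le> 0" using M_upper[of "{}"] nu_empty by simp
    show "M {} < q\<^sup>2 * N" using M_empty \<mu>q \<open>0 \<le> \<mu>\<close> by simp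
    show "M {} < M F" if F: "F \<subseteq> E" "F \<noteq> {}" for F
    proof -
      obtain e where e: "e \<in> F" using F(2) by blast
      \<comment> \<open>A single edge of weight 1 is a fractional matching, which already gives a
        positive value.\<close>
      define f where "f = (\<lambda>e'. of_bool (e' = e) :: real)"
      have "(\<Sum>e' | e' \<in> F \<and> v \<in> e'. f e') \<le> 1" for v
      proof -
        have "(\<Sum>e' | e' \<in> F \<and> v \<in> e'. f e') \<le> (\<Sum>e'\<in>F. f e')"
          using fin(1)[OF F(1)] by (intro sum_mono2) (auto simp: f_def)
        also have "\<dots> = 1" using fin(1)[OF F(1)] e by (simp add: f_def of_bool_def)
        finally show ?thesis .
      qed
      then have "fractional_matching F f" by (simp add: fractional_matching_def f_def)
      moreover have "(\<Sum>e'\<in>F. f e') = 1" using fin(1)[OF F(1)] e by (simp add: f_def of_bool_def)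
      ultimately have "q\<^sup>2 \<le> M F" using M_lower[OF F(1), of f] by simp
      moreover have "0 < q\<^sup>2" using q(1) by simp
      ultimately show ?thesis using M_empty by linarith
    qed
    show "supp (opt F) \<subseteq> F" if "F \<subseteq> E" for F using that by (rule supp_sub)
    show "M (supp (opt F)) = M F" if F: "F \<subseteq> E" for F
    proof (rule antisym)
      show "M (supp (opt F)) \<le> M F" using supp_sub[OF F] F by (rule M_mono)
      have "feasible b (supp (opt F)) (opt F)"
        using opt_feas[OF F] by (simp add: feasible_def supp_def)
      moreover have "supp (opt F) \<subseteq> E" using supp_sub[OF F] F by blast
      ultimately show "M F \<le> M (supp (opt F))" unfolding M_def using opt_max by blast
    qed
    show "supp (opt F) = supp (opt G)" if "F \<subseteq> E" "G \<subseteq> E" "M F = M G" for F G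
      using opt_eq[OF that] by simp
    show "M (F \<union> G) = M F" if FG: "F \<subseteq> E" "G \<subseteq> E" "M F = M G" for F G
    proof (rule antisym)
      have FG_E: "F \<union> G \<subseteq> E" using FG by blast
      show "M F \<le> M (F \<union> G)" using FG_E by (intro M_mono) auto
      \<comment> \<open>Equal values force equal optima, so \<open>opt F\<close> is a common optimum
        of \<open>F\<close> and \<open>G\<close>.\<close>
      have "optimal b w G (opt F)" using opt[OF FG(2)] opt_eq[OF FG] by simp
      then have "optimal b w (F \<union> G) (opt F)"
        by (rule optimal_Un[OF b(3) opt[OF FG(1)] _ FG(1,2)])
      then show "M (F \<union> G) \<le> M F" unfolding M_def using opt_feas[OF FG_E] by (simp add: optimal_def)
    qed
    show "card (supp (opt F)) \<le> nat (\<lceil>of_nat r * n\<rceil> - 1)" if F: "F \<subseteq> E" "M F < q\<^sup>2 * N" for F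
    proof -
      define x T where "x = opt F" and "T = tight b x"
      have x: "feasible b F x" using opt_feas[OF F(1)] by (simp add: x_def)
      have T: "T \<subseteq> V" "finite T" using V(1) by (auto simp: T_def tight_def)
      have card_V: "(\<Sum>v\<in>V. A v e) = real r" if "e \<in> E" for e
      proof -
        have "(\<Sum>v\<in>V. A v e) = (\<Sum>v\<in>e. 1)"
          unfolding A_def using V(1) V(2)[OF that] by (intro sum.mono_neutral_cong_right) auto
        then show ?thesis using V(3)[OF that] by simp
      qed
      \<comment> \<open>Double counting of loads: a tight vertex carries more than \<open>q\<close>,
        and each edge loads exactly \<open>r\<close> vertices with its weight.\<close>
      have "q * real (card T) = (\<Sum>v\<in>T. q)" by simp
      also have "\<dots> \<le> (\<Sum>v\<in>T. b v)" using b(1) by (intro sum_mono less_imp_le)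
      also have "\<dots> = (\<Sum>v\<in>T. \<Sum>e\<in>E. A v e * x e)" by (intro sum.cong) (auto simp: T_def tight_def)
      also have "\<dots> \<le> (\<Sum>v\<in>V. \<Sum>e\<in>E. A v e * x e)"
        using V(1) T(1) feas_nonneg[OF x]
        by (intro sum_mono2 sum_nonneg mult_nonneg_nonneg) (auto simp: A_def)
      also have "\<dots> = (\<Sum>e\<in>E. (\<Sum>v\<in>V. A v e) * x e)"
        unfolding sum_distrib_right by (rule sum.swap)
      also have "\<dots> = real r * (\<Sum>e\<in>E. x e)"
        unfolding sum_distrib_left by (intro sum.cong) (auto simp: card_V)
      also have "\<dots> \<le> real r * \<mu>"
      proof -
        have "F \<in> ?X" using F X_M by blast
        then show ?thesis
          using order.trans[OF total_le[OF F(1) x] nu_le[of F]] by (intro mult_left_mono) auto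
      qed
      also have "\<dots> < real r * (q\<^sup>2 * N)" using \<mu>q assms(1) by simp
      \<comment> \<open>One factor \<open>q\<close> is below 1 and is dropped; the other cancels
        against the lower bound on the capacities.\<close>
      also have "\<dots> \<le> real r * (q * N)"
        using q N by (intro mult_left_mono mult_right_mono) (auto simp: power2_eq_square mult_left_le)
      also have "\<dots> = q * (real r * N)" by simp
      finally have "real (card T) < real r * N" using q(1) by simp
      moreover have "card (supp x) \<le> card T"
        unfolding T_def x_def by (rule basic_card_le, rule optimal_basic[OF w(3) opt[OF F(1)] F(1)])
      ultimately have "real (card (supp x)) < real r * N" by linarith
      then have "(of_rat (of_nat (card (supp x))) :: real) < of_rat (of_nat r * n)"
        by (simp add: N_def of_rat_mult)
      then have "of_nat (card (supp x)) < of_nat r * n" unfolding of_rat_less .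
      then have "of_int (int (card (supp x))) < of_nat r * n" by simp
      \<comment> \<open>The strict bound by \<open>r n\<close> passes to its ceiling even if
        \<open>r n\<close> is an integer; this accounts for the 1 subtracted in the
        dimension.\<close>
      then have "int (card (supp x)) < \<lceil>of_nat r * n\<rceil>" by (simp only: less_ceiling_iff)
      then show ?thesis by (simp add: x_def)
    qed
  qed
qed

end
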